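(* Suppose $X$ is a paracompact space and $f:A\to Y$ is a map from a closed subset $A$ of $X$ to a space $Y$. Then $f$ extends to a map $U\to Y$ on some neighborhood $U$ of $A$ in $X$ if $Y$ is the union of a family $\{Y_s\}_{s\in S}$ of its subspaces with the following properties: (a) each $Y_s$ is an absolute neighborhood extensor of $X$; (b) for any two elements $s$ and $t$ of $S$ there is $u\in S$ such that $Y_s\cup Y_t\subset Y_u$; (c) $A=\bigcup_{s\in S}\operatorname{Int}_A(f^{-1}(Y_s))$.
   Context: Maps are continuous. Paracompact spaces are assumed Hausdorff. A space $Z$ is an absolute neighborhood extensor of a space $X$ if every map $g:B\to Z$ from a closed subset $B$ of $X$ extends over some neighborhood of $B$ in $X$. $\operatorname{Int}_A(B)$ is the interior of $B$ relative to $A$. *)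

theory Defs
  imports "HOL-Analysis.Analysis"
begin

definition paracompact_space :: "'a topology \<Rightarrow> bool" where
  "paracompact_space X \<longleftrightarrow>
     Hausdorff_space X \<and>
     (\<forall>\<U>. (\<forall>U\<in>\<U>. openin X U) \<and> \<Union>\<U> = topspace X \<longrightarrow>
        (\<exists>\<V>. (\<forall>V\<in>\<V>. openin X V) \<and> \<Union>\<V> = topspace X \<and>
             (\<forall>V\<in>\<V>. \<exists>U\<in>\<U>. V \<subseteq> U) \<and> locally_finite_in X \<V>))"

text \<open>A neighborhood of a set is any set containing it in its interior; it need not be open.\<close>

definition extends_over_neighborhood :: "'a topology \<Rightarrow> 'b topology \<Rightarrow> 'a set \<Rightarrow> ('a \<Rightarrow> 'b) \<Rightarrow> bool" where
  "extends_over_neighborhood X Z B g \<longleftrightarrow>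
     (\<exists>U h. U \<subseteq> topspace X \<and> B \<subseteq> X interior_of U \<and>
            continuous_map (subtopology X U) Z h \<and> (\<forall>x\<in>B. h x = g x))"

definition absolute_neighborhood_extensor :: "'b topology \<Rightarrow> 'a topology \<Rightarrow> bool" where
  "absolute_neighborhood_extensor Z X \<longleftrightarrow>
     (\<forall>B g. closedin X B \<and> continuous_map (subtopology X B) Z g
        \<longrightarrow> extends_over_neighborhood X Z B g)"

end

theory Submission
  imports Defs
begin

text \<open>
  On a piece of \<open>X\<close> whose trace on \<open>A\<close> is mapped into one \<open>Y\<^sub>s\<close>, the map \<open>f\<close> extends near \<open>A\<close>
  because \<open>Y\<^sub>s\<close> is an extensor; the difficulty is to make such extensions agree where pieces
  overlap. If the pieces are treated one after another, the values already fixed on an overlap must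
  lie in the member of the family that serves the next piece. So the pieces should be ordered
  such that those treated later, when they meet earlier ones, are allowed larger targets.
  A barycentric subdivision of the nerve of a cover has this shape: its cells are indexed by finite
  sets \<open>T\<close> of cover elements, two cells meet only if their index sets are comparable, and
  by directedness the targets \<open>Y\<^bsub>u(T)\<^esub>\<close> can be chosen monotone in \<open>T\<close>.

  Such cells are obtained directly. Take a locally finite open cover of \<open>X\<close> whose elements
  each have their trace on \<open>A\<close> mapped into a single \<open>Y\<^sub>s\<close>, and for each element \<open>V\<close> a
  continuous \<open>\<phi>\<^sub>V\<close> that vanishes off \<open>V\<close>, such that every point has some \<open>\<phi>\<^sub>V\<close> equal to 1. The cell of \<open>T\<close>
  consists of the points where \<open>\<phi>\<^sub>V \<ge> 1/n\<close> for \<open>V \<in> T\<close> and \<open>\<phi>\<^sub>V \<le> 1/(n+1)\<close> for the other \<open>V\<close>,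
  where \<open>n\<close> is the cardinality of \<open>T\<close>. These closed cells form a locally finite cover
  (\<open>threshold_cells_cover\<close>), and if two of them meet, the smaller index set is contained in the
  larger one (\<open>threshold_cell_subset\<close>). In particular, different cells of equal rank \<open>n\<close> are disjoint.

  The extension then proceeds by increasing rank (\<open>extension_over_ranked_closed_cover\<close>). At stage
  \<open>n\<close> all cells of rank \<open>n\<close> are treated independently (\<open>extension_over_disjoint_family\<close>), and each
  contributes a closed set that is a neighborhood, within the cell, of the part of the cell where the
  map was already defined. Near any point only finitely many cells, hence finitely many
  stages, matter; so the limit map is continuous and its domain is a neighborhood of \<open>A\<close>.
\<close>

section \<open>Paracompact spaces are normal and admit closed shrinkings\<close>

lemma normal_space_closure_in_open:
  assumes "normal_space X" "closedin X K" "openin X U" "K \<subseteq> U"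
  obtains V where "openin X V" "K \<subseteq> V" "X closure_of V \<subseteq> U"
proof -
  have "\<exists>V. openin X V \<and> K \<subseteq> V \<and> X closure_of V \<subseteq> U"
    using assms(1)[unfolded normal_space_alt, rule_format, of K U] assms(2-) by simp
  then show thesis
    using that by blast
qed

lemma paracompact_space_refinement:
  assumes "paracompact_space X" "\<And>U. U \<in> \<U> \<Longrightarrow> openin X U" "topspace X \<subseteq> \<Union>\<U>"
  obtains \<V> where "\<And>V. V \<in> \<V> \<Longrightarrow> openin X V" "\<Union>\<V> = topspace X"
    "\<And>V. V \<in> \<V> \<Longrightarrow> \<exists>U\<in>\<U>. V \<subseteq> U" "locally_finite_in X \<V>"
proof -
  have "\<Union>\<U> = topspace X"
    using assms openin_subset by blast
  then obtain \<V> where "\<forall>V\<in>\<V>. openin X V" "\<Union>\<V> = topspace X"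
      "\<forall>V\<in>\<V>. \<exists>U\<in>\<U>. V \<subseteq> U" "locally_finite_in X \<V>"
    using assms(1)[unfolded paracompact_space_def, THEN conjunct2, THEN spec, of \<U>] assms(2)
    by (elim impE) auto
  then show thesis
    by (intro that[of \<V>]) auto
qed

text \<open>
  Local finiteness is used to pass from points to closed sets: refine the cover by the sets that
  separate points of \<open>K\<close> from \<open>P\<close> together with the complement of \<open>K\<close>, and unite the elements of
  the refinement that meet \<open>K\<close>. The closure of this locally finite union is the union of the closures.
\<close>

lemma paracompact_space_separation:
  assumes X: "paracompact_space X" and K: "closedin X K"
    and sep: "\<And>x. x \<in> K \<Longrightarrow> \<exists>U. openin X U \<and> x \<in> U \<and> disjnt P (X closure_of U)"
  obtains U where "openin X U" "K \<subseteq> U" "disjnt P (X closure_of U)"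
proof -
  define \<U> where "\<U> = insert (topspace X - K) {U. openin X U \<and> disjnt P (X closure_of U)}"
  have "topspace X \<subseteq> \<Union>\<U>"
  proof
    fix x assume "x \<in> topspace X"
    then show "x \<in> \<Union>\<U>"
      using sep[of x] unfolding \<U>_def by blast
  qed
  moreover have "openin X U" if "U \<in> \<U>" for U
    using K that by (auto simp: \<U>_def)
  ultimately obtain \<V> where \<V>: "\<And>V. V \<in> \<V> \<Longrightarrow> openin X V" "\<Union>\<V> = topspace X"
      "\<And>V. V \<in> \<V> \<Longrightarrow> \<exists>U\<in>\<U>. V \<subseteq> U" "locally_finite_in X \<V>"
    using paracompact_space_refinement[OF X, of \<U>] by metis
  define \<W> where "\<W> = {V \<in> \<V>. V \<inter> K \<noteq> {}}"
  have lf: "locally_finite_in X \<W>"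
    using \<V>(4) by (rule locally_finite_in_subset) (auto simp: \<W>_def)
  have "disjnt P (X closure_of V)" if "V \<in> \<W>" for V
  proof -
    obtain U where "U \<in> \<U>" "V \<subseteq> U"
      using \<V>(3) \<open>V \<in> \<W>\<close> by (auto simp: \<W>_def)
    then have "disjnt P (X closure_of U)"
      using that by (auto simp: \<U>_def \<W>_def)
    then show ?thesis
      using closure_of_mono[OF \<open>V \<subseteq> U\<close>, of X] by (auto simp: disjnt_def)
  qed
  then have "disjnt P (X closure_of \<Union>\<W>)"
    using closure_of_locally_finite_Union[OF lf] by (auto simp: disjnt_def)
  moreover have "openin X (\<Union>\<W>)"
    using \<V>(1) by (auto simp: \<W>_def)
  moreover have "K \<subseteq> \<Union>\<W>"
    using closedin_subset[OF K] \<V>(2) by (fastforce simp: \<W>_def)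
  ultimately show thesis
    using that by blast
qed

text \<open>
  The separation lemma is applied twice: with \<open>P\<close> a point, where the Hausdorff axiom supplies the
  hypothesis and regularity results, and then with \<open>P\<close> a closed set, where regularity supplies it.
\<close>

lemma paracompact_imp_normal_space:
  assumes X: "paracompact_space X"
  shows "normal_space X"
proof -
  have H: "Hausdorff_space X"
    using X unfolding paracompact_space_def by (rule conjunct1)
  have regular: "\<exists>U. openin X U \<and> K \<subseteq> U \<and> disjnt {p} (X closure_of U)"
    if K: "closedin X K" and p: "p \<in> topspace X" "p \<notin> K" for K p
  proof -
    have "\<exists>U. openin X U \<and> x \<in> U \<and> disjnt {p} (X closure_of U)" if "x \<in> K" for x
    proof -
      have "x \<in> topspace X" "x \<noteq> p"
        using p \<open>x \<in> K\<close> closedin_subset[OF K] by auto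
      then obtain U V where "openin X U" "openin X V" "x \<in> U" "p \<in> V" "disjnt U V"
        using H p(1) unfolding Hausdorff_space_def by meson
      then have "p \<notin> X closure_of U"
        by (auto simp: in_closure_of disjnt_iff)
      with \<open>openin X U\<close> \<open>x \<in> U\<close> show ?thesis
        by auto
    qed
    then show ?thesis
      by (rule paracompact_space_separation[OF X K]) auto
  qed
  show ?thesis
    unfolding normal_space
  proof clarify
    fix K L
    assume K: "closedin X K" and L: "closedin X L" and "disjnt K L"
    have "\<exists>U. openin X U \<and> x \<in> U \<and> disjnt L (X closure_of U)" if "x \<in> K" for x
    proof -
      obtain V where V: "openin X V" "L \<subseteq> V" "disjnt {x} (X closure_of V)"
        using regular[OF L, of x] \<open>x \<in> K\<close> \<open>disjnt K L\<close> closedin_subset[OF K]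
        by (auto simp: disjnt_iff)
      let ?U = "topspace X - X closure_of V"
      have "X closure_of ?U \<subseteq> topspace X - V"
        by (meson Diff_mono V(1) closedin_diff closedin_topspace closure_of_minimal
            closure_of_subset openin_subset order_refl)
      with V show ?thesis
        using \<open>x \<in> K\<close> closedin_subset[OF K]
        by (intro exI[of _ ?U]) (auto simp: disjnt_iff)
    qed
    then show "\<exists>U. openin X U \<and> K \<subseteq> U \<and> disjnt L (X closure_of U)"
      by (rule paracompact_space_separation[OF X K]) auto
  qed
qed

text \<open>
  Refine to a locally finite cover \<open>\<W>\<close> whose elements have closures inside elements of \<open>\<V>\<close>, and
  let \<open>F V\<close> collect all the closures that lie in \<open>V\<close>.
\<close>

lemma paracompact_space_closed_shrinking:
  assumes X: "paracompact_space X"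
    and \<V>: "\<And>V. V \<in> \<V> \<Longrightarrow> openin X V" "\<Union>\<V> = topspace X"
  obtains F where "\<And>V. V \<in> \<V> \<Longrightarrow> closedin X (F V)" "\<And>V. V \<in> \<V> \<Longrightarrow> F V \<subseteq> V"
    "\<Union>(F ` \<V>) = topspace X"
proof -
  have norm: "normal_space X"
    by (rule paracompact_imp_normal_space[OF X])
  have H: "Hausdorff_space X"
    using X unfolding paracompact_space_def by (rule conjunct1)
  define \<U> where "\<U> = {U. openin X U \<and> (\<exists>V\<in>\<V>. X closure_of U \<subseteq> V)}"
  have "\<exists>U\<in>\<U>. x \<in> U" if x: "x \<in> topspace X" for x
  proof -
    obtain V where V: "V \<in> \<V>" "x \<in> V"
      using x unfolding \<V>(2)[symmetric] by blast
    have "closedin X {x}"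
      using H x by (rule closedin_Hausdorff_singleton)
    moreover have "{x} \<subseteq> V"
      using V(2) by simp
    ultimately obtain U where "openin X U" "{x} \<subseteq> U" "X closure_of U \<subseteq> V"
      by (rule normal_space_closure_in_open[OF norm _ \<V>(1)[OF V(1)]])
    then show ?thesis
      using V(1) by (intro bexI[of _ U]) (auto simp: \<U>_def)
  qed
  then have "topspace X \<subseteq> \<Union>\<U>"
    by blast
  moreover have "openin X U" if "U \<in> \<U>" for U
    using that by (simp add: \<U>_def)
  ultimately obtain \<W> where \<W>: "\<And>W. W \<in> \<W> \<Longrightarrow> openin X W" "\<Union>\<W> = topspace X"
      "\<And>W. W \<in> \<W> \<Longrightarrow> \<exists>U\<in>\<U>. W \<subseteq> U" "locally_finite_in X \<W>"
    using paracompact_space_refinement[OF X, of \<U>] by metis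
  define F where "F V = \<Union>((\<lambda>W. X closure_of W) ` {W \<in> \<W>. X closure_of W \<subseteq> V})" for V
  show thesis
  proof
    show "closedin X (F V)" for V
      unfolding F_def
      by (intro closedin_Union_locally_finite_closure locally_finite_in_subset[OF \<W>(4)]) auto
    show "F V \<subseteq> V" for V
      by (auto simp: F_def)
    have "\<exists>V\<in>\<V>. W \<subseteq> F V" if W: "W \<in> \<W>" for W
    proof -
      obtain U V where "W \<subseteq> U" "V \<in> \<V>" "X closure_of U \<subseteq> V"
        using \<W>(3)[OF W] by (auto simp: \<U>_def)
      then have "X closure_of W \<subseteq> V"
        by (meson closure_of_mono order_trans)
      moreover have "W \<subseteq> X closure_of W"
        using \<W>(1)[OF W] by (simp add: closure_of_subset openin_subset)
      ultimately show ?thesis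
        using W \<open>V \<in> \<V>\<close> by (auto simp: F_def)
    qed
    then have "topspace X \<subseteq> \<Union>(F ` \<V>)"
      unfolding \<W>(2)[symmetric] by blast
    moreover have "F V \<subseteq> topspace X" for V
      by (auto simp: F_def in_closure_of)
    ultimately show "\<Union>(F ` \<V>) = topspace X"
      by auto
  qed
qed

section \<open>Extending along a closed cover filtered by rank\<close>

lemma absolute_neighborhood_extensor_closed_nbhd:
  assumes norm: "normal_space X" and Z: "absolute_neighborhood_extensor Z X"
    and B: "closedin X B" and g: "continuous_map (subtopology X B) Z g"
  obtains G h where "openin X G" "B \<subseteq> G"
    "continuous_map (subtopology X (X closure_of G)) Z h" "\<And>x. x \<in> B \<Longrightarrow> h x = g x"
proof -
  obtain U h where U: "B \<subseteq> X interior_of U" and h: "continuous_map (subtopology X U) Z h"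
      "\<forall>x\<in>B. h x = g x"
    using Z[unfolded absolute_neighborhood_extensor_def, rule_format, of B g] B g
    unfolding extends_over_neighborhood_def by auto
  obtain G where G: "openin X G" "B \<subseteq> G" "X closure_of G \<subseteq> X interior_of U"
    by (rule normal_space_closure_in_open[OF norm B openin_interior_of U])
  have "X closure_of G \<subseteq> U"
    using G(3) interior_of_subset by (rule order_trans)
  then have "continuous_map (subtopology X (X closure_of G)) Z h"
    by (rule continuous_map_from_subtopology_mono[OF h(1)])
  with G h(2) that show thesis
    by blast
qed

text \<open>
  One stage of the construction. On each \<open>C j\<close> the map is extended from \<open>N \<inter> C j\<close> to the closed set
  \<open>M j\<close>, the part of \<open>C j\<close> in the closure of an open neighborhood \<open>G j\<close> of \<open>N \<inter> C j\<close>.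
  The sets \<open>M j\<close> are disjoint and meet \<open>N\<close> only in \<open>N \<inter> C j\<close>, where the maps agree, so everything
  pastes. The clauses beyond continuity are what the next stages need: the new values are controlled on
  every \<open>C j\<close>, and the new domain is a neighborhood of the old one relative to each \<open>C j\<close>.
\<close>

lemma extension_over_disjoint_family:
  fixes C :: "'j \<Rightarrow> 'a set" and Z :: "'j \<Rightarrow> 'b set"
  assumes norm: "normal_space X" and N: "closedin X N"
    and h: "continuous_map (subtopology X N) Y h"
    and ane: "\<And>j. j \<in> J \<Longrightarrow> absolute_neighborhood_extensor (subtopology Y (Z j)) X"
    and clo: "\<And>j. j \<in> J \<Longrightarrow> closedin X (C j)"
    and lf: "\<And>x. x \<in> topspace X \<Longrightarrow> \<exists>V. openin X V \<and> x \<in> V \<and> finite {j \<in> J. C j \<inter> V \<noteq> {}}"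
    and disj: "\<And>i j. \<lbrakk>i \<in> J; j \<in> J; C i \<inter> C j \<noteq> {}\<rbrakk> \<Longrightarrow> i = j"
    and hZ: "\<And>j x. \<lbrakk>j \<in> J; x \<in> N; x \<in> C j\<rbrakk> \<Longrightarrow> h x \<in> Z j"
  shows "\<exists>N' h'. closedin X N' \<and> continuous_map (subtopology X N') Y h' \<and>
           N \<subseteq> N' \<and> N' \<subseteq> N \<union> (\<Union>j\<in>J. C j) \<and> (\<forall>x\<in>N. h' x = h x) \<and>
           (\<forall>j\<in>J. \<forall>x\<in>N'. x \<in> C j \<longrightarrow> h' x \<in> Z j) \<and>
           (\<forall>j\<in>J. \<exists>G. openin X G \<and> N \<inter> C j \<subseteq> G \<and> G \<inter> C j \<subseteq> N')"
proof -
  have "\<exists>G g. openin X G \<and> N \<inter> C j \<subseteq> G \<and>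
      continuous_map (subtopology X (X closure_of G)) (subtopology Y (Z j)) g \<and>
      (\<forall>x\<in>N \<inter> C j. g x = h x)" if j: "j \<in> J" for j
  proof -
    have B: "closedin X (N \<inter> C j)"
      using N clo[OF j] by blast
    have "continuous_map (subtopology X (N \<inter> C j)) Y h"
      by (rule continuous_map_from_subtopology_mono[OF h]) auto
    moreover have "h \<in> topspace (subtopology X (N \<inter> C j)) \<rightarrow> Z j"
      using hZ[OF j] by auto
    ultimately have "continuous_map (subtopology X (N \<inter> C j)) (subtopology Y (Z j)) h"
      by (rule continuous_map_into_subtopology)
    from absolute_neighborhood_extensor_closed_nbhd[OF norm ane[OF j] B this] show ?thesis
      by metis
  qed
  then obtain G g where G: "\<And>j. j \<in> J \<Longrightarrow> openin X (G j)" "\<And>j. j \<in> J \<Longrightarrow> N \<inter> C j \<subseteq> G j"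
    and g: "\<And>j. j \<in> J \<Longrightarrow>
      continuous_map (subtopology X (X closure_of G j)) (subtopology Y (Z j)) (g j)"
      "\<And>j x. \<lbrakk>j \<in> J; x \<in> N; x \<in> C j\<rbrakk> \<Longrightarrow> g j x = h x"
    by (metis IntI)
  define M where "M j = X closure_of G j \<inter> C j" for j
  define N' where "N' = N \<union> (\<Union>j\<in>J. M j)"
  define h' where "h' x = (if x \<in> N then h x else g (SOME j. j \<in> J \<and> x \<in> M j) x)" for x
  have M: "closedin X (M j)" if "j \<in> J" for j
    using clo[OF that] by (auto simp: M_def)
  have h'_N: "h' x = h x" if "x \<in> N" for x
    using that by (simp add: h'_def)
  have h'_M: "h' x = g j x" if "j \<in> J" "x \<in> M j" for j x
  proof (cases "x \<in> N")
    case True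
    then show ?thesis
      using g(2) that by (simp add: h'_def M_def)
  next
    case False
    have "(SOME i. i \<in> J \<and> x \<in> M i) = j"
    proof (rule some_equality)
      show "i = j" if "i \<in> J \<and> x \<in> M i" for i
        using disj[of i j] that \<open>j \<in> J\<close> \<open>x \<in> M j\<close> by (auto simp: M_def)
    qed (use that in auto)
    with False show ?thesis
      by (simp add: h'_def)
  qed
  have M_sub: "M j \<subseteq> C j" for j
    by (auto simp: M_def)
  have lfM: "\<exists>V. openin X V \<and> x \<in> V \<and> finite {j \<in> J. M j \<inter> V \<noteq> {}}"
    if x: "x \<in> topspace X" for x
  proof -
    obtain V where V: "openin X V" "x \<in> V" "finite {j \<in> J. C j \<inter> V \<noteq> {}}"
      using lf[OF x] by blast
    have "{j \<in> J. M j \<inter> V \<noteq> {}} \<subseteq> {j \<in> J. C j \<inter> V \<noteq> {}}"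
      using M_sub by blast
    with V show ?thesis
      using finite_subset by blast
  qed
  \<comment> \<open>The pasting is over one family: \<open>None\<close> stands for \<open>N\<close> with the old map, \<open>Some j\<close> for \<open>M j\<close>.\<close>
  let ?I = "insert None (Some ` J)"
  let ?T = "\<lambda>i. case i of None \<Rightarrow> N | Some j \<Rightarrow> M j"
  let ?k = "\<lambda>i. case i of None \<Rightarrow> h | Some j \<Rightarrow> g j"
  have fin: "finite {i \<in> ?I. ?T i \<inter> V \<noteq> {}}" if "finite {j \<in> J. M j \<inter> V \<noteq> {}}" for V
  proof (rule finite_subset)
    show "{i \<in> ?I. ?T i \<inter> V \<noteq> {}} \<subseteq> insert None (Some ` {j \<in> J. M j \<inter> V \<noteq> {}})"
      by (auto simp: image_iff)
  qed (use that in auto)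
  have cloN': "closedin X N'"
  proof -
    have "locally_finite_in X (M ` J)"
      unfolding locally_finite_in_def
    proof (intro conjI ballI)
      show "\<Union> (M ` J) \<subseteq> topspace X"
        using M closedin_subset by blast
      fix x assume "x \<in> topspace X"
      then obtain V where V: "openin X V" "x \<in> V" "finite {j \<in> J. M j \<inter> V \<noteq> {}}"
        using lfM by blast
      have "{U \<in> M ` J. U \<inter> V \<noteq> {}} = M ` {j \<in> J. M j \<inter> V \<noteq> {}}"
        by auto
      with V show "\<exists>V. openin X V \<and> x \<in> V \<and> finite {U \<in> M ` J. U \<inter> V \<noteq> {}}"
        by (metis (no_types, lifting) finite_imageI)
    qed
    then have "closedin X (\<Union>(M ` J))"
      using M by (intro closedin_locally_finite_Union) auto
    with N show ?thesis
      by (simp add: N'_def closedin_Un)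
  qed
  have "continuous_map (subtopology X N') Y h'"
  proof (rule pasting_lemma_locally_finite[where I = ?I and T = ?T and f = ?k])
    fix x assume "x \<in> topspace (subtopology X N')"
    then have x: "x \<in> topspace X" "x \<in> N'"
      by auto
    obtain V where V: "openin X V" "x \<in> V" "finite {j \<in> J. M j \<inter> V \<noteq> {}}"
      using lfM[OF x(1)] by blast
    have "{j \<in> J. M j \<inter> (N' \<inter> V) \<noteq> {}} \<subseteq> {j \<in> J. M j \<inter> V \<noteq> {}}"
      by auto
    then have "finite {j \<in> J. M j \<inter> (N' \<inter> V) \<noteq> {}}"
      using V(3) finite_subset by blast
    then show "\<exists>V. openin (subtopology X N') V \<and> x \<in> V \<and> finite {i \<in> ?I. ?T i \<inter> V \<noteq> {}}"
      using V(1,2) x(2) fin[of "N' \<inter> V"]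
      by (intro exI[of _ "N' \<inter> V"]) (simp add: openin_subtopology_Int2)
  next
    fix i assume "i \<in> ?I"
    then show "closedin (subtopology X N') (?T i)"
      using N M by (auto intro!: closedin_subset_topspace simp: N'_def)
  next
    fix i assume i: "i \<in> ?I"
    have "continuous_map (subtopology X (?T i)) Y (?k i)"
    proof (cases i)
      case None
      then show ?thesis
        using h by simp
    next
      case (Some j)
      then have "j \<in> J"
        using i by auto
      then have "continuous_map (subtopology X (M j)) Y (g j)"
        by (intro continuous_map_from_subtopology_mono[OF continuous_map_into_fulltopology[OF g(1)]])
           (auto simp: M_def)
      with Some show ?thesis
        by simp
    qed
    moreover have "?T i \<subseteq> N'"
      using i by (auto simp: N'_def)
    ultimately show "continuous_map (subtopology (subtopology X N') (?T i)) Y (?k i)"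
      by (simp add: subtopology_subtopology inf.absorb2)
  next
    fix i i' x
    assume i: "i \<in> ?I" "i' \<in> ?I" and x: "x \<in> topspace (subtopology X N') \<inter> ?T i \<inter> ?T i'"
    have "?k i x = h' x" if "i \<in> ?I" "x \<in> ?T i" for i
      using that h'_N h'_M by auto
    from this[of i] this[of i'] show "?k i x = ?k i' x"
      using i x by simp
  next
    fix x assume "x \<in> topspace (subtopology X N')"
    then have "x \<in> N \<or> (\<exists>j\<in>J. x \<in> M j)"
      by (auto simp: N'_def)
    then show "\<exists>i. i \<in> ?I \<and> x \<in> ?T i \<and> h' x = ?k i x"
    proof
      assume "x \<in> N"
      then show ?thesis
        using h'_N by (intro exI[of _ None]) auto
    next
      assume "\<exists>j\<in>J. x \<in> M j"
      then obtain j where "j \<in> J" "x \<in> M j" ..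
      then show ?thesis
        using h'_M by (intro exI[of _ "Some j"]) auto
    qed
  qed
  moreover have "h' x \<in> Z j" if j: "j \<in> J" and x: "x \<in> N'" "x \<in> C j" for j x
  proof (cases "x \<in> N")
    case True
    then show ?thesis
      using hZ j x h'_N by simp
  next
    case False
    then obtain i where i: "i \<in> J" "x \<in> M i"
      using x(1) by (auto simp: N'_def)
    then have "i = j"
      using disj[of i j] j x(2) M_sub by blast
    have "x \<in> topspace (subtopology X (X closure_of G j))"
      using i \<open>i = j\<close> by (auto simp: M_def in_closure_of)
    then have "g j x \<in> Z j"
      using g(1)[OF j] by (auto simp: continuous_map_in_subtopology)
    then show ?thesis
      using h'_M i \<open>i = j\<close> by simp
  qed
  moreover have "\<exists>U. openin X U \<and> N \<inter> C j \<subseteq> U \<and> U \<inter> C j \<subseteq> N'" if j: "j \<in> J" for j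
    using G[OF j] closure_of_subset[OF openin_subset[OF G(1)[OF j]]] j
    by (intro exI[of _ "G j"]) (auto simp: N'_def M_def)
  ultimately show ?thesis
    using cloN' h'_N M_sub
    by (intro exI[of _ N'] exI[of _ h']) (fastforce simp: N'_def)
qed

text \<open>
  Stages are indexed by rank, lowest first. At stage \<open>n\<close> a point outside \<open>A\<close> where the map is already
  defined lies in some cell of lower rank and is mapped into the target of that cell. If it also lies
  in a cell of rank at least \<open>n\<close>, monotonicity of the targets along meeting cells puts its image in the
  target of the latter, so that the extensor property of this target can be applied.
\<close>

lemma extension_over_ranked_closed_cover:
  fixes C :: "'j \<Rightarrow> 'a set" and Z :: "'j \<Rightarrow> 'b set" and r :: "'j \<Rightarrow> nat"
  assumes norm: "normal_space X" and A: "closedin X A"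
    and f: "continuous_map (subtopology X A) Y f"
    and ane: "\<And>j. j \<in> J \<Longrightarrow> absolute_neighborhood_extensor (subtopology Y (Z j)) X"
    and clo: "\<And>j. j \<in> J \<Longrightarrow> closedin X (C j)"
    and lf: "\<And>x. x \<in> topspace X \<Longrightarrow> \<exists>V. openin X V \<and> x \<in> V \<and> finite {j \<in> J. C j \<inter> V \<noteq> {}}"
    and cover: "topspace X \<subseteq> (\<Union>j\<in>J. C j)"
    and same_rank: "\<And>i j. \<lbrakk>i \<in> J; j \<in> J; r i = r j; C i \<inter> C j \<noteq> {}\<rbrakk> \<Longrightarrow> i = j"
    and less_rank: "\<And>i j. \<lbrakk>i \<in> J; j \<in> J; r i < r j; C i \<inter> C j \<noteq> {}\<rbrakk> \<Longrightarrow> Z i \<subseteq> Z j"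
    and fZ: "\<And>j x. \<lbrakk>j \<in> J; x \<in> A; x \<in> C j\<rbrakk> \<Longrightarrow> f x \<in> Z j"
  shows "extends_over_neighborhood X Y A f"
proof -
  \<comment> \<open>State before stage \<open>n\<close>: cells still to be treated see admissible values, and relative to each
    cell already treated the domain is a neighborhood of the part of \<open>A\<close> in that cell.\<close>
  define P where "P n p \<longleftrightarrow> (case p of (N, h) \<Rightarrow>
      closedin X N \<and> A \<subseteq> N \<and> continuous_map (subtopology X N) Y h \<and> (\<forall>x\<in>A. h x = f x) \<and>
      (\<forall>j\<in>J. n \<le> r j \<longrightarrow> (\<forall>x\<in>N. x \<in> C j \<longrightarrow> h x \<in> Z j)) \<and>
      (\<forall>j\<in>J. r j < n \<longrightarrow> (\<exists>G. openin X G \<and> A \<inter> C j \<subseteq> G \<and> G \<inter> C j \<subseteq> N)))"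
    for n :: nat and p :: "'a set \<times> ('a \<Rightarrow> 'b)"
  define Q where "Q n p q \<longleftrightarrow> fst p \<subseteq> fst q \<and> fst q \<subseteq> fst p \<union> (\<Union>j\<in>{j \<in> J. r j = n}. C j) \<and>
      (\<forall>x\<in>fst p. snd q x = snd p x)"
    for n :: nat and p q :: "'a set \<times> ('a \<Rightarrow> 'b)"
  have "\<exists>q. P (Suc n) q \<and> Q n p q" if P: "P n p" for n p
  proof -
    obtain N h where p: "p = (N, h)"
      by (cases p)
    have N: "closedin X N" "A \<subseteq> N" and h: "continuous_map (subtopology X N) Y h"
      and hf: "\<forall>x\<in>A. h x = f x"
      and hZ: "\<And>j x. \<lbrakk>j \<in> J; n \<le> r j; x \<in> N; x \<in> C j\<rbrakk> \<Longrightarrow> h x \<in> Z j"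
      and nbhd: "\<And>j. \<lbrakk>j \<in> J; r j < n\<rbrakk> \<Longrightarrow> \<exists>G. openin X G \<and> A \<inter> C j \<subseteq> G \<and> G \<inter> C j \<subseteq> N"
      using P unfolding P_def p by auto
    let ?J = "{j \<in> J. r j = n}"
    have lf': "\<exists>V. openin X V \<and> x \<in> V \<and> finite {j \<in> ?J. C j \<inter> V \<noteq> {}}"
      if x: "x \<in> topspace X" for x
    proof -
      obtain V where V: "openin X V" "x \<in> V" "finite {j \<in> J. C j \<inter> V \<noteq> {}}"
        using lf[OF x] by blast
      have "{j \<in> ?J. C j \<inter> V \<noteq> {}} \<subseteq> {j \<in> J. C j \<inter> V \<noteq> {}}"
        by auto
      with V show ?thesis
        using finite_subset by blast
    qed
    have "\<exists>N' h'. closedin X N' \<and> continuous_map (subtopology X N') Y h' \<and>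
           N \<subseteq> N' \<and> N' \<subseteq> N \<union> (\<Union>j\<in>?J. C j) \<and> (\<forall>x\<in>N. h' x = h x) \<and>
           (\<forall>j\<in>?J. \<forall>x\<in>N'. x \<in> C j \<longrightarrow> h' x \<in> Z j) \<and>
           (\<forall>j\<in>?J. \<exists>G. openin X G \<and> N \<inter> C j \<subseteq> G \<and> G \<inter> C j \<subseteq> N')"
      by (rule extension_over_disjoint_family[OF norm N(1) h _ _ lf'])
         (use ane clo same_rank hZ in auto)
    then obtain N' h' where N': "closedin X N'" "continuous_map (subtopology X N') Y h'"
      "N \<subseteq> N'" "N' \<subseteq> N \<union> (\<Union>j\<in>?J. C j)" "\<forall>x\<in>N. h' x = h x"
      and h'Z: "\<And>j x. \<lbrakk>j \<in> J; r j = n; x \<in> N'; x \<in> C j\<rbrakk> \<Longrightarrow> h' x \<in> Z j"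
      and nbhd': "\<And>j. \<lbrakk>j \<in> J; r j = n\<rbrakk> \<Longrightarrow> \<exists>G. openin X G \<and> N \<inter> C j \<subseteq> G \<and> G \<inter> C j \<subseteq> N'"
      by auto
    have "h' x \<in> Z k" if k: "k \<in> J" "Suc n \<le> r k" and x: "x \<in> N'" "x \<in> C k" for k x
    proof (cases "x \<in> N")
      case True
      then show ?thesis
        using hZ[of k x] k x N'(5) by simp
    next
      case False
      then obtain j where j: "j \<in> J" "r j = n" "x \<in> C j"
        using N'(4) x(1) by blast
      then have "Z j \<subseteq> Z k"
        using less_rank[of j k] k x by auto
      then show ?thesis
        using h'Z[OF j(1,2) x(1) j(3)] by blast
    qed
    moreover have "\<exists>G. openin X G \<and> A \<inter> C j \<subseteq> G \<and> G \<inter> C j \<subseteq> N'"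
      if j: "j \<in> J" "r j < Suc n" for j
    proof (cases "r j = n")
      case True
      then obtain G where "openin X G" "N \<inter> C j \<subseteq> G" "G \<inter> C j \<subseteq> N'"
        using nbhd'[OF j(1)] by blast
      then show ?thesis
        using N(2) by (intro exI[of _ G]) auto
    next
      case False
      then obtain G where "openin X G" "A \<inter> C j \<subseteq> G" "G \<inter> C j \<subseteq> N"
        using nbhd[OF j(1)] j(2) by auto
      then show ?thesis
        using N'(3) by (intro exI[of _ G]) auto
    qed
    ultimately have "P (Suc n) (N', h')"
      using N N' hf by (auto simp: P_def)
    moreover have "Q n p (N', h')"
      using N' by (simp add: Q_def p)
    ultimately show ?thesis
      by blast
  qed
  moreover have "\<exists>p. P 0 p"
    using A f fZ by (intro exI[of _ "(A, f)"]) (simp add: P_def)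
  ultimately obtain s where s: "\<And>n. P n (s n)" "\<And>n. Q n (s n) (s (Suc n))"
    using dependent_nat_choice[of P Q] by metis
  define N where "N n = fst (s n)" for n
  define h where "h n = snd (s n)" for n
  have P: "closedin X (N n)" "A \<subseteq> N n" "continuous_map (subtopology X (N n)) Y (h n)"
    "\<And>x. x \<in> A \<Longrightarrow> h n x = f x" for n
    using s(1)[of n] by (auto simp: P_def N_def h_def split: prod.splits)
  have nbhd: "\<exists>G. openin X G \<and> A \<inter> C j \<subseteq> G \<and> G \<inter> C j \<subseteq> N n" if "j \<in> J" "r j < n" for j n
    using s(1)[of n] that by (auto simp: P_def N_def split: prod.splits)
  have N_Suc: "N n \<subseteq> N (Suc n)" "N (Suc n) \<subseteq> N n \<union> (\<Union>j\<in>{j \<in> J. r j = n}. C j)"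
    and h_Suc: "\<And>x. x \<in> N n \<Longrightarrow> h (Suc n) x = h n x" for n
    using s(2)[of n] by (auto simp: Q_def N_def h_def)
  have N_mono: "N m \<subseteq> N n" if "m \<le> n" for m n
    using N_Suc(1) that by (rule lift_Suc_mono_le)
  have h_eq: "h n x = h m x" if "m \<le> n" "x \<in> N m" for m n x
    using that
  proof (induction n rule: dec_induct)
    case (step n)
    then have "x \<in> N n"
      using N_mono by blast
    with step show ?case
      by (simp add: h_Suc)
  qed simp
  define U where "U = (\<Union>n. N n)"
  define F where "F x = h (LEAST n. x \<in> N n) x" for x
  have F: "F x = h n x" if "x \<in> N n" for x n
    unfolding F_def
    by (rule h_eq[symmetric]) (use that in \<open>auto intro: Least_le LeastI\<close>)
  \<comment> \<open>Near a point the domain no longer grows once the ranks of the finitely many cells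
    present there are exhausted.\<close>
  have stable: "\<exists>V m. openin X V \<and> x \<in> V \<and> finite {j \<in> J. C j \<inter> V \<noteq> {}} \<and>
      (\<forall>j\<in>J. C j \<inter> V \<noteq> {} \<longrightarrow> r j < m) \<and> V \<inter> U \<subseteq> N m" if x: "x \<in> topspace X" for x
  proof -
    obtain V where V: "openin X V" "x \<in> V" and fin: "finite {j \<in> J. C j \<inter> V \<noteq> {}}"
      using lf[OF x] by blast
    obtain m where m: "\<forall>k\<in>r ` {j \<in> J. C j \<inter> V \<noteq> {}}. k < m"
      using fin finite_nat_set_iff_bounded by blast
    have "V \<inter> N n \<subseteq> N m" for n
    proof (induction n)
      case 0
      then show ?case
        using N_mono[of 0 m] by auto
    next
      case (Suc n)
      show ?case
      proof (cases "n < m")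
        case True
        then show ?thesis
          using N_mono[of "Suc n" m] by auto
      next
        case False
        then have "V \<inter> C j = {}" if "j \<in> J" "r j = n" for j
          using m that by auto
        then show ?thesis
          using N_Suc(2)[of n] Suc by blast
      qed
    qed
    then have "V \<inter> U \<subseteq> N m"
      by (auto simp: U_def)
    with V fin m show ?thesis
      by (intro exI[of _ V] exI[of _ m]) auto
  qed
  have "continuous_map (subtopology X U) Y F"
  proof (rule pasting_lemma[where I = "{(V, m). openin X V \<and> V \<inter> U \<subseteq> N m}"
        and T = "\<lambda>p. U \<inter> fst p" and f = "\<lambda>p. h (snd p)"])
    fix p assume "p \<in> {(V, m). openin X V \<and> V \<inter> U \<subseteq> N m}"
    then have p: "openin X (fst p)" "U \<inter> fst p \<subseteq> N (snd p)"
      by auto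
    show "openin (subtopology X U) (U \<inter> fst p)"
      using p(1) by (rule openin_subtopology_Int2)
    have "continuous_map (subtopology X (U \<inter> fst p)) Y (h (snd p))"
      by (rule continuous_map_from_subtopology_mono[OF P(3) p(2)])
    then show "continuous_map (subtopology (subtopology X U) (U \<inter> fst p)) Y (h (snd p))"
      by (simp add: subtopology_subtopology)
  next
    fix p q x
    assume "p \<in> {(V, m). openin X V \<and> V \<inter> U \<subseteq> N m}"
      and "q \<in> {(V, m). openin X V \<and> V \<inter> U \<subseteq> N m}"
      and "x \<in> topspace (subtopology X U) \<inter> (U \<inter> fst p) \<inter> (U \<inter> fst q)"
    then have "x \<in> N (snd p)" "x \<in> N (snd q)"
      by auto
    then show "h (snd p) x = h (snd q) x"
      using F by metis
  next
    fix x assume "x \<in> topspace (subtopology X U)"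
    then have x: "x \<in> topspace X" "x \<in> U"
      by auto
    obtain V m where V: "openin X V" "x \<in> V" "V \<inter> U \<subseteq> N m"
      using stable[OF x(1)] by blast
    then have "F x = h m x"
      using F x by blast
    with V x show "\<exists>p. p \<in> {(V, m). openin X V \<and> V \<inter> U \<subseteq> N m} \<and> x \<in> U \<inter> fst p \<and>
        F x = h (snd p) x"
      by (intro exI[of _ "(V, m)"]) simp
  qed
  moreover have "A \<subseteq> X interior_of U"
  proof
    fix a assume a: "a \<in> A"
    then have a_top: "a \<in> topspace X"
      using closedin_subset[OF A] by blast
    obtain V m where V: "openin X V" "a \<in> V" and fin: "finite {j \<in> J. C j \<inter> V \<noteq> {}}"
      and m: "\<forall>j\<in>J. C j \<inter> V \<noteq> {} \<longrightarrow> r j < m"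
      using stable[OF a_top] by blast
    \<comment> \<open>The cells cover \<open>X\<close>, so it is enough to find inside each of the finitely many cells near
      \<open>a\<close> a relative neighborhood of \<open>a\<close>, which may be empty when \<open>a\<close> is not in the cell.\<close>
    have "\<exists>G. openin X G \<and> a \<in> G \<and> G \<inter> C j \<subseteq> U" if j: "j \<in> {j \<in> J. C j \<inter> V \<noteq> {}}" for j
    proof (cases "a \<in> C j")
      case True
      obtain G where "openin X G" "A \<inter> C j \<subseteq> G" "G \<inter> C j \<subseteq> N m"
        using nbhd[of j m] j m by auto
      with True a show ?thesis
        by (intro exI[of _ G]) (auto simp: U_def)
    next
      case False
      then show ?thesis
        using clo[of j] j a_top by (intro exI[of _ "topspace X - C j"]) auto
    qed
    then obtain G where G: "\<And>j. j \<in> {j \<in> J. C j \<inter> V \<noteq> {}} \<Longrightarrow>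
        openin X (G j) \<and> a \<in> G j \<and> G j \<inter> C j \<subseteq> U"
      by metis
    define W where "W = V \<inter> (\<Inter>j\<in>{j \<in> J. C j \<inter> V \<noteq> {}}. G j)"
    have "openin X W"
    proof (cases "{j \<in> J. C j \<inter> V \<noteq> {}} = {}")
      case True
      then show ?thesis
        using V(1) unfolding W_def by (metis INT_empty Int_UNIV_right)
    next
      case False
      then show ?thesis
        unfolding W_def using V(1) fin G by (intro openin_Int openin_INT2) auto
    qed
    moreover have "a \<in> W"
      using V(2) G by (auto simp: W_def)
    moreover have "W \<subseteq> U"
    proof
      fix x assume x: "x \<in> W"
      then have "x \<in> V"
        by (simp add: W_def)
      then obtain j where j: "j \<in> J" "x \<in> C j"
        using cover openin_subset[OF V(1)] by blast
      then have "x \<in> G j" "G j \<inter> C j \<subseteq> U"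
        using x \<open>x \<in> V\<close> G[of j] by (auto simp: W_def)
      then show "x \<in> U"
        using j by blast
    qed
    ultimately show "a \<in> X interior_of U"
      by (auto simp: interior_of_def)
  qed
  moreover have "U \<subseteq> topspace X"
    using P(1) closedin_subset by (auto simp: U_def)
  moreover have "F a = f a" if "a \<in> A" for a
    using F[of a 0] P(2)[of 0] P(4)[of a 0] that by auto
  ultimately show ?thesis
    unfolding extends_over_neighborhood_def by blast
qed

section \<open>Cells of a locally finite family of functions\<close>

text \<open>
  The gap between \<open>1/n\<close> and \<open>1/(n+1)\<close>, with \<open>n\<close> the cardinality of \<open>T\<close>, separates the indices in \<open>T\<close>
  from the others. The upper threshold for \<open>T\<close> is the lower threshold for sets with one more
  element, which is what lets the cells cover without letting cells of incomparable sets meet.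
\<close>

definition threshold_cell :: "'a topology \<Rightarrow> ('i \<Rightarrow> 'a \<Rightarrow> real) \<Rightarrow> 'i set \<Rightarrow> 'i set \<Rightarrow> 'a set" where
  "threshold_cell X \<phi> I T = {x \<in> topspace X.
     (\<forall>i\<in>T. 1 / real (card T) \<le> \<phi> i x) \<and> (\<forall>i\<in>I - T. \<phi> i x \<le> 1 / real (Suc (card T)))}"

lemma closedin_threshold_cell:
  assumes \<phi>: "\<And>i. i \<in> I \<Longrightarrow> continuous_map X euclideanreal (\<phi> i)" and T: "T \<subseteq> I"
  shows "closedin X (threshold_cell X \<phi> I T)"
proof -
  have ge: "closedin X {x \<in> topspace X. c \<le> \<phi> i x}" if "i \<in> I" for i c
    using \<phi>[OF that] by (simp add: continuous_map_upper_lower_semicontinuous_le)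
  have le: "closedin X {x \<in> topspace X. \<phi> i x \<le> c}" if "i \<in> I" for i c
    using \<phi>[OF that] by (simp add: continuous_map_upper_lower_semicontinuous_le)
  let ?\<C> = "insert (topspace X)
      ((\<lambda>i. {x \<in> topspace X. 1 / real (card T) \<le> \<phi> i x}) ` T \<union>
       (\<lambda>i. {x \<in> topspace X. \<phi> i x \<le> 1 / real (Suc (card T))}) ` (I - T))"
  have "closedin X (\<Inter>?\<C>)"
  proof (rule closedin_Inter)
    show "closedin X K" if "K \<in> ?\<C>" for K
      using that ge le T by blast
  qed auto
  moreover have "threshold_cell X \<phi> I T = \<Inter>?\<C>"
    unfolding threshold_cell_def by blast
  ultimately show ?thesis
    by simp
qed

text \<open>
  At a common point, an index in \<open>S\<close> but not in \<open>T\<close> would have a value of at least \<open>1/|S|\<close> and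
  at most \<open>1/(|T|+1)\<close>, which forces \<open>|T| < |S|\<close>.
\<close>

lemma threshold_cell_subset:
  assumes x: "x \<in> threshold_cell X \<phi> I S" "x \<in> threshold_cell X \<phi> I T"
    and S: "S \<subseteq> I" "finite S" and card: "card S \<le> card T"
  shows "S \<subseteq> T"
proof
  fix i assume i: "i \<in> S"
  show "i \<in> T"
  proof (rule ccontr)
    assume "i \<notin> T"
    then have "1 / real (card S) \<le> \<phi> i x" "\<phi> i x \<le> 1 / real (Suc (card T))"
      using x i S(1) by (auto simp: threshold_cell_def)
    then have "1 / real (card S) \<le> 1 / real (Suc (card T))"
      by linarith
    moreover have "0 < card S"
      using i S(2) by (auto simp: card_gt_0_iff)
    ultimately have "Suc (card T) \<le> card S"
      by (simp add: field_simps)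
    with card show False
      by simp
  qed
qed

text \<open>
  Let \<open>L n\<close> be the set of indices whose value at \<open>x\<close> is at least \<open>1/n\<close>, and take the largest
  \<open>n\<close> for which \<open>L n\<close> has at least \<open>n\<close> elements. Then \<open>L (n+1)\<close> has at most \<open>n\<close> elements
  and contains \<open>L n\<close>, so both are equal with exactly \<open>n\<close> elements: no value lies
  strictly above \<open>1/(n+1)\<close> and below \<open>1/n\<close>, and \<open>T = L n\<close> works.
\<close>

lemma threshold_cells_cover:
  assumes x: "x \<in> topspace X" and fin: "finite {i \<in> I. 0 < \<phi> i x}"
    and one: "i \<in> I" "1 \<le> \<phi> i x"
  obtains T where "finite T" "T \<noteq> {}" "T \<subseteq> I" "x \<in> threshold_cell X \<phi> I T"
proof -
  define L where "L n = {i \<in> I. 1 / real n \<le> \<phi> i x}" for n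
  have L_sub: "L n \<subseteq> {i \<in> I. 0 < \<phi> i x}" if "0 < n" for n
  proof
    fix i assume "i \<in> L n"
    then have "i \<in> I" "1 / real n \<le> \<phi> i x"
      by (auto simp: L_def)
    moreover have "0 < 1 / real n"
      using that by simp
    ultimately show "i \<in> {i \<in> I. 0 < \<phi> i x}"
      by (auto simp del: zero_less_divide_1_iff)
  qed
  then have fin_L: "finite (L n)" if "0 < n" for n
    using that fin finite_subset by blast
  define good where "good n \<longleftrightarrow> 0 < n \<and> n \<le> card (L n)" for n
  have "i \<in> L 1"
    using one by (simp add: L_def)
  then have "good 1"
    using fin_L[of 1] by (auto simp: good_def Suc_le_eq card_gt_0_iff)
  have bound: "n \<le> card {i \<in> I. 0 < \<phi> i x}" if "good n" for n
    using that card_mono[OF fin L_sub[of n]] by (auto simp: good_def)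
  define n where "n = (GREATEST n. good n)"
  have n: "good n"
    unfolding n_def using \<open>good 1\<close> bound by (rule GreatestI_nat)
  have "\<not> good (Suc n)"
    using Greatest_le_nat[of good "Suc n", OF _ bound] unfolding n_def by force
  then have small: "card (L (Suc n)) \<le> n"
    by (simp add: good_def)
  have "L n \<subseteq> L (Suc n)"
  proof
    fix i assume "i \<in> L n"
    moreover have "1 / real (Suc n) \<le> 1 / real n"
      using n by (intro divide_left_mono) (auto simp: good_def)
    ultimately show "i \<in> L (Suc n)"
      unfolding L_def by auto
  qed
  then have eq: "L (Suc n) = L n"
    using small n fin_L[of "Suc n"] by (intro card_seteq[symmetric]) (auto simp: good_def)
  then have card: "card (L n) = n"
    using small n by (simp add: good_def)
  show thesis
  proof
    show "finite (L n)" "L n \<noteq> {}"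
      using n fin_L[of n] card by (auto simp: good_def)
    show "L n \<subseteq> I"
      by (auto simp: L_def)
    have "\<phi> i x \<le> 1 / real (Suc n)" if "i \<in> I" "i \<notin> L n" for i
    proof -
      have "i \<notin> L (Suc n)"
        using that eq by simp
      then show ?thesis
        using that(1) by (simp add: L_def)
    qed
    then show "x \<in> threshold_cell X \<phi> I (L n)"
      using x by (auto simp: threshold_cell_def card) (auto simp: L_def)
  qed
qed

section \<open>Proof of the extension theorem\<close>

text \<open>
  Pairwise upper bounds need not be chosen coherently. Choosing \<open>u T\<close> by recursion on the finite set
  \<open>T\<close>, above all \<open>\<sigma> i\<close> with \<open>i \<in> T\<close> and above the finitely many \<open>u R\<close> with \<open>R \<subset> T\<close>, makes the
  choice monotone.
\<close>

lemma directed_family_monotone_bounds: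
  fixes Ys :: "'s \<Rightarrow> 'b set" and \<sigma> :: "'i \<Rightarrow> 's"
  assumes directed: "\<And>s t. \<lbrakk>s \<in> S; t \<in> S\<rbrakk> \<Longrightarrow> \<exists>u\<in>S. Ys s \<union> Ys t \<subseteq> Ys u"
    and "S \<noteq> {}" and \<sigma>: "\<And>i. i \<in> I \<Longrightarrow> \<sigma> i \<in> S"
  obtains u where "\<And>T. \<lbrakk>finite T; T \<subseteq> I\<rbrakk> \<Longrightarrow> u T \<in> S"
    "\<And>T i. \<lbrakk>finite T; T \<subseteq> I; i \<in> T\<rbrakk> \<Longrightarrow> Ys (\<sigma> i) \<subseteq> Ys (u T)"
    "\<And>T T'. \<lbrakk>finite T'; T' \<subseteq> I; T \<subset> T'\<rbrakk> \<Longrightarrow> Ys (u T) \<subseteq> Ys (u T')"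
proof -
  have bound: "\<exists>u\<in>S. \<forall>s\<in>R. Ys s \<subseteq> Ys u" if "finite R" "R \<subseteq> S" for R
    using that
  proof (induction R rule: finite_induct)
    case empty
    then show ?case
      using \<open>S \<noteq> {}\<close> by auto
  next
    case (insert s R)
    then obtain u where u: "u \<in> S" "\<forall>s\<in>R. Ys s \<subseteq> Ys u"
      by auto
    obtain v where "v \<in> S" "Ys s \<union> Ys u \<subseteq> Ys v"
      using directed[of s u] insert.prems u(1) by auto
    with u(2) show ?case
      by (intro bexI[of _ v]) auto
  qed
  define P where "P u T v \<longleftrightarrow> (finite T \<and> T \<subseteq> I \<longrightarrow>
      v \<in> S \<and> (\<forall>i\<in>T. Ys (\<sigma> i) \<subseteq> Ys v) \<and> (\<forall>R. R \<subset> T \<longrightarrow> Ys (u R) \<subseteq> Ys v))"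
    for u :: "'i set \<Rightarrow> 's" and T v
  have "\<exists>u. \<forall>T. P u T (u T)"
  proof (rule dependent_wf_choice[OF wf_finite_psubset])
    fix u u' :: "'i set \<Rightarrow> 's" and T v
    assume *: "\<And>R. (R, T) \<in> finite_psubset \<Longrightarrow> u R = u' R"
    show "P u T v = P u' T v"
    proof (cases "finite T")
      case True
      then have "u R = u' R" if "R \<subset> T" for R
        using * that by simp
      then show ?thesis
        by (simp add: P_def)
    qed (simp add: P_def)
  next
    fix T and u :: "'i set \<Rightarrow> 's"
    assume IH: "\<And>R. (R, T) \<in> finite_psubset \<Longrightarrow> P u R (u R)"
    show "\<exists>v. P u T v"
    proof (cases "finite T \<and> T \<subseteq> I")
      case True
      have "u R \<in> S" if "R \<subset> T" for R
      proof -
        have "finite R" "R \<subseteq> I"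
          using True that finite_subset[of R T] by auto
        then show ?thesis
          using IH[of R] True that by (simp add: P_def)
      qed
      moreover have "finite {R. R \<subset> T}"
        by (rule finite_subset[of _ "Pow T"]) (use True in auto)
      ultimately have "\<exists>v\<in>S. \<forall>s\<in>\<sigma> ` T \<union> u ` {R. R \<subset> T}. Ys s \<subseteq> Ys v"
        using True \<sigma> by (intro bound) auto
      then obtain v where "v \<in> S" "\<forall>s\<in>\<sigma> ` T \<union> u ` {R. R \<subset> T}. Ys s \<subseteq> Ys v"
        by blast
      then show ?thesis
        by (intro exI[of _ v]) (simp add: P_def)
    qed (auto simp: P_def)
  qed
  then obtain u where "\<And>T. P u T (u T)"
    by blast
  then show thesis
    by (intro that[of u]) (auto simp: P_def)
qed

theorem corollary1p7:
  fixes X :: "'a topology" and Y :: "'b topology"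
    and A :: "'a set" and f :: "'a \<Rightarrow> 'b"
    and S :: "'s set" and Ys :: "'s \<Rightarrow> 'b set"
  assumes "paracompact_space X"
    and "closedin X A"
    and "continuous_map (subtopology X A) Y f"
    and "topspace Y = (\<Union>s\<in>S. Ys s)"
    and "\<And>s. s \<in> S \<Longrightarrow> absolute_neighborhood_extensor (subtopology Y (Ys s)) X"
    and "\<And>s t. s \<in> S \<Longrightarrow> t \<in> S \<Longrightarrow> \<exists>u\<in>S. Ys s \<union> Ys t \<subseteq> Ys u"
    and "A = (\<Union>s\<in>S. (subtopology X A) interior_of {x \<in> A. f x \<in> Ys s})"
  shows "extends_over_neighborhood X Y A f"
proof (cases "S = {}")
  case True
  then have "A = {}"
    using assms(7) by simp
  then show ?thesis
    unfolding extends_over_neighborhood_def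
    by (intro exI[of _ "{}"]) (simp add: continuous_map_on_empty)
next
  case False
  note X = assms(1) and A = assms(2)
  have norm: "normal_space X"
    by (rule paracompact_imp_normal_space[OF X])
  \<comment> \<open>The complement of \<open>A\<close> also belongs to this family, since its trace on \<open>A\<close> is empty; so the
    family covers \<open>X\<close> and not just \<open>A\<close>.\<close>
  define \<U> where "\<U> = {U. openin X U \<and> (\<exists>s\<in>S. f ` (U \<inter> A) \<subseteq> Ys s)}"
  have "topspace X \<subseteq> \<Union>\<U>"
  proof
    fix x assume x: "x \<in> topspace X"
    show "x \<in> \<Union>\<U>"
    proof (cases "x \<in> A")
      case True
      then obtain s where s: "s \<in> S" "x \<in> (subtopology X A) interior_of {x \<in> A. f x \<in> Ys s}"
        using assms(7) by blast
      then obtain W where "openin (subtopology X A) W" "x \<in> W" "W \<subseteq> {x \<in> A. f x \<in> Ys s}"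
        unfolding interior_of_def by blast
      then obtain U where "openin X U" "x \<in> U" "U \<inter> A \<subseteq> {x \<in> A. f x \<in> Ys s}"
        unfolding openin_subtopology by blast
      then show ?thesis
        using s(1) by (intro UnionI[of U]) (auto simp: \<U>_def)
    next
      case notin: False
      have "openin X (topspace X - A)"
        using A by blast
      then show ?thesis
        using x notin False by (intro UnionI[of "topspace X - A"]) (auto simp: \<U>_def)
    qed
  qed
  moreover have "openin X U" if "U \<in> \<U>" for U
    using that by (simp add: \<U>_def)
  ultimately obtain \<V> where \<V>: "\<And>V. V \<in> \<V> \<Longrightarrow> openin X V" "\<Union>\<V> = topspace X"
      "\<And>V. V \<in> \<V> \<Longrightarrow> \<exists>U\<in>\<U>. V \<subseteq> U" "locally_finite_in X \<V>"
    using paracompact_space_refinement[OF X, of \<U>] by metis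
  have "\<exists>s\<in>S. f ` (V \<inter> A) \<subseteq> Ys s" if "V \<in> \<V>" for V
    using \<V>(3)[OF that] unfolding \<U>_def by blast
  then obtain \<sigma> where \<sigma>: "\<And>V. V \<in> \<V> \<Longrightarrow> \<sigma> V \<in> S" "\<And>V. V \<in> \<V> \<Longrightarrow> f ` (V \<inter> A) \<subseteq> Ys (\<sigma> V)"
    by metis
  obtain F where F: "\<And>V. V \<in> \<V> \<Longrightarrow> closedin X (F V)" "\<And>V. V \<in> \<V> \<Longrightarrow> F V \<subseteq> V"
      "\<Union>(F ` \<V>) = topspace X"
    using paracompact_space_closed_shrinking[OF X \<V>(1,2)] by metis
  have "\<exists>\<phi>. continuous_map X euclideanreal \<phi> \<and> \<phi> ` (topspace X - V) \<subseteq> {0} \<and> \<phi> ` F V \<subseteq> {1}"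
    if V: "V \<in> \<V>" for V
  proof -
    have "closedin X (topspace X - V)" "disjnt (topspace X - V) (F V)"
      using \<V>(1)[OF V] F(2)[OF V] by (auto simp: disjnt_def)
    then obtain \<phi> where "continuous_map X euclideanreal \<phi>" "\<phi> ` (topspace X - V) \<subseteq> {0::real}"
        "\<phi> ` F V \<subseteq> {1}"
      using Urysohn_lemma_alt[OF norm _ F(1)[OF V]] by blast
    then show ?thesis
      by blast
  qed
  then obtain \<phi> where \<phi>: "\<And>V. V \<in> \<V> \<Longrightarrow> continuous_map X euclideanreal (\<phi> V)"
      "\<And>V. V \<in> \<V> \<Longrightarrow> \<phi> V ` (topspace X - V) \<subseteq> {0}" "\<And>V. V \<in> \<V> \<Longrightarrow> \<phi> V ` F V \<subseteq> {1}"
    by metis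
  have \<phi>_pos: "x \<in> V" if "V \<in> \<V>" "x \<in> topspace X" "0 < \<phi> V x" for V x
    using \<phi>(2)[OF that(1)] that(2,3) by (force simp: image_subset_iff)
  obtain u where u: "\<And>T. \<lbrakk>finite T; T \<subseteq> \<V>\<rbrakk> \<Longrightarrow> u T \<in> S"
      "\<And>T V. \<lbrakk>finite T; T \<subseteq> \<V>; V \<in> T\<rbrakk> \<Longrightarrow> Ys (\<sigma> V) \<subseteq> Ys (u T)"
      "\<And>T T'. \<lbrakk>finite T'; T' \<subseteq> \<V>; T \<subset> T'\<rbrakk> \<Longrightarrow> Ys (u T) \<subseteq> Ys (u T')"
    using directed_family_monotone_bounds[where I = \<V> and \<sigma> = \<sigma>, OF assms(6) False \<sigma>(1)] by metis
  define J where "J = {T. finite T \<and> T \<noteq> {} \<and> T \<subseteq> \<V>}"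
  let ?C = "threshold_cell X \<phi> \<V>"
  have C_sub: "x \<in> V" if T: "T \<in> J" "V \<in> T" and x: "x \<in> ?C T" for T V x
  proof (rule \<phi>_pos)
    have "1 / real (card T) \<le> \<phi> V x"
      using x T(2) by (simp add: threshold_cell_def)
    moreover have "0 < 1 / real (card T)"
      using T(1) by (simp add: J_def card_gt_0_iff)
    ultimately show "0 < \<phi> V x"
      by linarith
  qed (use T x in \<open>auto simp: J_def threshold_cell_def\<close>)
  have subset: "T \<subseteq> T'" if T: "T \<in> J" and meet: "?C T \<inter> ?C T' \<noteq> {}" and le: "card T \<le> card T'" for T T'
  proof -
    obtain x where "x \<in> ?C T" "x \<in> ?C T'"
      using meet by blast
    then show ?thesis
      by (rule threshold_cell_subset) (use T le in \<open>auto simp: J_def\<close>)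
  qed
  show ?thesis
  proof (rule extension_over_ranked_closed_cover
      [OF norm A assms(3), where J = J and C = ?C and r = card and Z = "\<lambda>T. Ys (u T)"])
    show "absolute_neighborhood_extensor (subtopology Y (Ys (u T))) X" if "T \<in> J" for T
      using that by (intro assms(5) u(1)) (auto simp: J_def)
    show "closedin X (?C T)" if "T \<in> J" for T
      by (rule closedin_threshold_cell) (use that \<phi>(1) in \<open>auto simp: J_def\<close>)
    show "\<exists>W. openin X W \<and> x \<in> W \<and> finite {T \<in> J. ?C T \<inter> W \<noteq> {}}"
      if x: "x \<in> topspace X" for x
    proof -
      obtain W where W: "openin X W" "x \<in> W" "finite {V \<in> \<V>. V \<inter> W \<noteq> {}}"
        using \<V>(4) x unfolding locally_finite_in_def by blast
      have "{T \<in> J. ?C T \<inter> W \<noteq> {}} \<subseteq> Pow {V \<in> \<V>. V \<inter> W \<noteq> {}}"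
        using C_sub by (fastforce simp: J_def)
      then have "finite {T \<in> J. ?C T \<inter> W \<noteq> {}}"
        using W(3) by (meson finite_Pow_iff finite_subset)
      with W show ?thesis
        by blast
    qed
    show "topspace X \<subseteq> (\<Union>T\<in>J. ?C T)"
    proof
      fix x assume x: "x \<in> topspace X"
      obtain W where W: "openin X W" "x \<in> W" "finite {V \<in> \<V>. V \<inter> W \<noteq> {}}"
        using \<V>(4) x unfolding locally_finite_in_def by blast
      have "{V \<in> \<V>. 0 < \<phi> V x} \<subseteq> {V \<in> \<V>. V \<inter> W \<noteq> {}}"
        using \<phi>_pos x W(2) by blast
      then have fin: "finite {V \<in> \<V>. 0 < \<phi> V x}"
        using W(3) finite_subset by blast
      obtain V where "V \<in> \<V>" "x \<in> F V"
        using x unfolding F(3)[symmetric] by blast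
      moreover from this have "1 \<le> \<phi> V x"
        using \<phi>(3)[of V] by (auto simp: image_subset_iff)
      ultimately obtain T where "finite T" "T \<noteq> {}" "T \<subseteq> \<V>" "x \<in> ?C T"
        using threshold_cells_cover[where I = \<V> and \<phi> = \<phi>, OF x fin] by metis
      then show "x \<in> (\<Union>T\<in>J. ?C T)"
        by (auto simp: J_def)
    qed
    show "T = T'" if "T \<in> J" "T' \<in> J" "card T = card T'" "?C T \<inter> ?C T' \<noteq> {}" for T T'
    proof
      show "T \<subseteq> T'"
        using subset[of T T'] that by simp
      show "T' \<subseteq> T"
        using subset[of T' T] that by (simp add: Int_commute)
    qed
    show "Ys (u T) \<subseteq> Ys (u T')"
      if "T \<in> J" "T' \<in> J" "card T < card T'" "?C T \<inter> ?C T' \<noteq> {}" for T T'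
    proof (rule u(3))
      have "T \<subseteq> T'"
        using subset[of T T'] that by simp
      with that(3) show "T \<subset> T'"
        by auto
    qed (use that in \<open>auto simp: J_def\<close>)
    show "f x \<in> Ys (u T)" if T: "T \<in> J" and x: "x \<in> A" "x \<in> ?C T" for T x
    proof -
      obtain V where V: "V \<in> T" "V \<in> \<V>"
        using T by (auto simp: J_def)
      then have "f x \<in> Ys (\<sigma> V)"
        using \<sigma>(2)[of V] C_sub[OF T V(1) x(2)] x(1) by blast
      then show ?thesis
        using u(2)[of T V] T V(1) by (auto simp: J_def)
    qed
  qed
qed

end
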